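(* Let $w\in S_n$ be a non-vexillary permutation and fix an anti-diagonal term order. For any elusive minor $\boldsymbol{m}$ of $I_w$, let $\mathcal{E}_{\boldsymbol{m}}$ be the set of elusive minors strictly contained in $\boldsymbol{m}$, and write $\boldsymbol{m}=\sum_{\boldsymbol{t}\in\mathfrak{T}(\boldsymbol{m})}c_{\boldsymbol{t}}\boldsymbol{t}$ with $c_{\boldsymbol{t}}=\pm1$. Then $$\boldsymbol{m}\xrightarrow[*]{\mathcal{E}_{\boldsymbol{m}}}\sum_{\boldsymbol{t}\in\mathfrak{T}(\boldsymbol{m})\setminus\mathfrak{R}(\boldsymbol{m},\mathcal{E}_{\boldsymbol{m}})}c_{\boldsymbol{t}}\boldsymbol{t},$$ i.e. $\boldsymbol{m}$ can be reduced modulo $\mathcal{E}_{\boldsymbol{m}}$, by finitely many reduction steps, to the polynomial on the right, and that polynomial is reduced modulo $\mathcal{E}_{\boldsymbol{m}}$.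
   Context: Let $K$ be a field, $X=(x_{ij})$ a generic $n\times n$ matrix of distinct variables, $K[\boldsymbol{x}]$ the polynomial ring in its entries, and $[n]=\{1,\dots,n\}$. For a matrix $M$, $M_{pq}$ is its northwest $p\times q$ submatrix. For $w=w_1\cdots w_n\in S_n$, $w^T$ is the $n\times n$ permutation matrix whose $i$th row has $1$ in column $w_i$ and $0$ elsewhere. The Schubert determinantal ideal $I_w$ is generated by all minors of $X_{pq}$ of size $\mathrm{rank}(w^T_{pq})+1$ for all $p,q\in[n]$. The Rothe diagram $D(w)$ is the set of boxes of an $n\times n$ square remaining after removing, for each $i$, the box $(i,w_i)$, all boxes $(k,w_i)$ with $k>i$, and all boxes $(i,l)$ with $l>w_i$. $\mathrm{Ess}(w)=\{(p,q)\in D(w): (p,q+1)\notin D(w)\text{ and }(p+1,q)\notin D(w)\}$. The Fulton generators of $I_w$ are the minors of $X_{pq}$ of size $\mathrm{rank}(w^T_{pq})+1$ for $(p,q)\in\mathrm{Ess}(w)$. $w$ is vexillary if there are no $i<j<k<\ell$ with $w_j<w_i<w_\ell<w_k$. A minor $\boldsymbol{m}$ is represented by its row and column index sets $R(\boldsymbol{m}),C(\boldsymbol{m})$. A Fulton generator $\boldsymbol{m}$ for $(p,q)\in\mathrm{Ess}(w)$ attends $X_{\tilde p\tilde q}$, for $(\tilde p,\tilde q)\in\mathrm{Ess}(w)\setminus\{(p,q)\}$, if (1) $\#(R(\boldsymbol{m})\cap[\tilde p])\ge\mathrm{rank}(w^T_{\tilde p\tilde q})+1$ and $\#(C(\boldsymbol{m})\cap[\tilde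 q])=\mathrm{rank}(w^T_{pq})+1$, or (2) $\#(R(\boldsymbol{m})\cap[\tilde p])=\mathrm{rank}(w^T_{pq})+1$ and $\#(C(\boldsymbol{m})\cap[\tilde q])\ge\mathrm{rank}(w^T_{\tilde p\tilde q})+1$. It is elusive if it does not attend $X_{\tilde p\tilde q}$ for any $(\tilde p,\tilde q)\in\mathrm{Ess}(w)\setminus\{(p,q)\}$ with $\mathrm{rank}(w^T_{\tilde p\tilde q})<\mathrm{rank}(w^T_{pq})$. A term is a monomial; $\mathfrak{T}(F)$ is the set of terms appearing in $F$ with nonzero coefficient; $\mathrm{lt},\mathrm{lc}$ are leading term and leading coefficient. A term order is anti-diagonal if the leading term of every minor of $X$ is the product of the anti-diagonal entries of its submatrix. $\boldsymbol{m}_2$ is contained in $\boldsymbol{m}_1$ if $R(\boldsymbol{m}_2)\subseteq R(\boldsymbol{m}_1)$ and $C(\boldsymbol{m}_2)\subseteq C(\boldsymbol{m}_1)$, strictly if moreover $\boldsymbol{m}_2\ne\boldsymbol{m}_1$; then the complement $\overline{\boldsymbol{m}_2}$ of $\boldsymbol{m}_2$ in $\boldsymbol{m}_1$ is the minor with rows $R(\boldsymbol{m}_1)\setminus R(\boldsymbol{m}_2)$ and columns $C(\boldsymbol{m}_1)\setminus C(\boldsymbol{m}_2)$, and the removed terms are $\mathfrak{R}(\boldsymbol{m}_1,\boldsymbol{m}_2)=\{\boldsymbol{t}\,\overline{\boldsymbol{t}}:\boldsymbol{t}\in\mathfrak{T}(\boldsymbol{m}_2),\overline{\boldsymbol{t}}\in\mathfrak{T}(\overline{\boldsymbol{m}_2})\}$.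 For a set $\mathcal{M}$ of minors strictly contained in $\boldsymbol{m}$, $\mathfrak{R}(\boldsymbol{m},\mathcal{M})=\bigcup_{\boldsymbol{f}\in\mathcal{M}}\mathfrak{R}(\boldsymbol{m},\boldsymbol{f})$. Reduction: $P$ is reducible modulo a set $\mathcal{Q}$ if some $\boldsymbol{t}\in\mathfrak{T}(P)$ is divisible by $\mathrm{lt}(Q)$ for some $Q\in\mathcal{Q}$; otherwise it is reduced modulo $\mathcal{Q}$. A reduction step replaces $P$ by $P-\frac{c}{\mathrm{lc}(Q)}\frac{\boldsymbol{t}}{\mathrm{lt}(Q)}Q$, where $Q\in\mathcal{Q}$, $\boldsymbol{t}\in\mathfrak{T}(P)$, $\mathrm{lt}(Q)\mid\boldsymbol{t}$ and $c$ is the coefficient of $\boldsymbol{t}$ in $P$. $P\xrightarrow[*]{\mathcal{Q}}\overline P$ means that $\overline P$ is obtained from $P$ by finitely many reduction steps modulo $\mathcal{Q}$ and is reduced modulo $\mathcal{Q}$. *)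

theory Defs
  imports
    "HOL-Library.Poly_Mapping"
    "HOL-Combinatorics.Permutations"
    "Jordan_Normal_Form.Determinant"
    "Jordan_Normal_Form.DL_Rank"
begin

section \<open>Polynomials, terms and term orders\<close>

text \<open>
  A monomial in the variables \<open>var i j\<close> is its exponent vector, so that monomials multiply by
  \<open>+\<close>, the monomial 1 is \<open>0\<close> and a quotient of monomials is a difference. The set
  \<open>\<TT>(F)\<close> of terms of a polynomial \<open>F\<close> is \<^term>\<open>Poly_Mapping.keys F\<close>, and the coefficient of \<open>t\<close> is
  \<^term>\<open>Poly_Mapping.lookup F t\<close>. The variable type is infinite; the polynomial ring in the entries of an
  \<open>n \<times> n\<close> matrix consists of the polynomials whose terms lie in \<open>terms_upto n\<close>.
\<close>

type_synonym monomial = "(nat \<times> nat) \<Rightarrow>\<^sub>0 nat"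
type_synonym 'a polynomial = "monomial \<Rightarrow>\<^sub>0 'a"

definition var :: "nat \<Rightarrow> nat \<Rightarrow> 'a::comm_ring_1 polynomial" where
  "var i j = Poly_Mapping.single (Poly_Mapping.single (i, j) 1) 1"

definition terms_upto :: "nat \<Rightarrow> monomial set" where
  "terms_upto n = {t. Poly_Mapping.keys t \<subseteq> {1..n} \<times> {1..n}}"

definition term_dvd :: "monomial \<Rightarrow> monomial \<Rightarrow> bool" where
  "term_dvd s t \<longleftrightarrow> (\<exists>u. t = s + u)"

text \<open>\<open>(s, t) \<in> tord\<close> means \<open>s \<le> t\<close>.\<close>

definition term_order :: "nat \<Rightarrow> monomial rel \<Rightarrow> bool" where
  "term_order n tord \<longleftrightarrow>
     linear_order_on (terms_upto n) tord \<and>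
     (\<forall>t \<in> terms_upto n. (0, t) \<in> tord) \<and>
     (\<forall>s t. \<forall>u \<in> terms_upto n. (s, t) \<in> tord \<longrightarrow> (s + u, t + u) \<in> tord)"

text \<open>Only meaningful for nonzero polynomials.\<close>

definition lead_term :: "monomial rel \<Rightarrow> 'a::field polynomial \<Rightarrow> monomial" where
  "lead_term tord P = (THE t. t \<in> Poly_Mapping.keys P \<and> (\<forall>s \<in> Poly_Mapping.keys P. (s, t) \<in> tord))"

definition lead_coef :: "monomial rel \<Rightarrow> 'a::field polynomial \<Rightarrow> 'a" where
  "lead_coef tord P = Poly_Mapping.lookup P (lead_term tord P)"


section \<open>Reduction\<close>

definition reducible :: "monomial rel \<Rightarrow> 'a::field polynomial set \<Rightarrow> 'a polynomial \<Rightarrow> bool" where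
  "reducible tord \<Q> P \<longleftrightarrow>
     (\<exists>t \<in> Poly_Mapping.keys P. \<exists>Q \<in> \<Q>. Q \<noteq> 0 \<and> term_dvd (lead_term tord Q) t)"

definition red_step ::
  "monomial rel \<Rightarrow> 'a::field polynomial set \<Rightarrow> 'a polynomial \<Rightarrow> 'a polynomial \<Rightarrow> bool" where
  "red_step tord \<Q> P P' \<longleftrightarrow>
     (\<exists>Q \<in> \<Q>. \<exists>t \<in> Poly_Mapping.keys P. Q \<noteq> 0 \<and> term_dvd (lead_term tord Q) t \<and>
        P' = P - Poly_Mapping.single (t - lead_term tord Q) (Poly_Mapping.lookup P t / lead_coef tord Q) * Q)"

definition reduces_to ::
  "monomial rel \<Rightarrow> 'a::field polynomial set \<Rightarrow> 'a polynomial \<Rightarrow> 'a polynomial \<Rightarrow> bool" where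
  "reduces_to tord \<Q> P P' \<longleftrightarrow> (red_step tord \<Q>)\<^sup>*\<^sup>* P P' \<and> \<not> reducible tord \<Q> P'"


section \<open>Minors of the generic matrix\<close>

text \<open>A minor is represented by its row and column index sets (R, C); indices start at 1.\<close>

type_synonym minor = "nat set \<times> nat set"

text \<open>
  Matrices of type \<^typ>\<open>'a mat\<close> are indexed from 0: the row a and column b of the submatrix of
  the generic matrix belong to the element number a of R and the element number b of C, in
  increasing order.
\<close>

definition minor_poly :: "minor \<Rightarrow> 'a::comm_ring_1 polynomial" where
  "minor_poly = (\<lambda>(R, C). det (mat (card R) (card C)
     (\<lambda>(a, b). var (sorted_list_of_set R ! a) (sorted_list_of_set C ! b))))"

text \<open>The minors of size k of the northwest p \<open>\<times>\<close> q submatrix.\<close>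

definition minors :: "nat \<Rightarrow> nat \<Rightarrow> nat \<Rightarrow> minor set" where
  "minors p q k = {(R, C). R \<subseteq> {1..p} \<and> C \<subseteq> {1..q} \<and> card R = k \<and> card C = k}"

definition antidiag_term :: "minor \<Rightarrow> monomial" where
  "antidiag_term = (\<lambda>(R, C). \<Sum>a<card R. Poly_Mapping.single
     (sorted_list_of_set R ! a, sorted_list_of_set C ! (card C - 1 - a)) 1)"

definition antidiagonal_order :: "'a::field itself \<Rightarrow> nat \<Rightarrow> monomial rel \<Rightarrow> bool" where
  "antidiagonal_order (_ :: 'a itself) n tord \<longleftrightarrow> term_order n tord \<and>
     (\<forall>k. \<forall>m \<in> minors n n k. lead_term tord (minor_poly m :: 'a polynomial) = antidiag_term m)"

definition contained :: "minor \<Rightarrow> minor \<Rightarrow> bool" where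
  "contained m2 m1 \<longleftrightarrow> fst m2 \<subseteq> fst m1 \<and> snd m2 \<subseteq> snd m1"

definition strictly_contained :: "minor \<Rightarrow> minor \<Rightarrow> bool" where
  "strictly_contained m2 m1 \<longleftrightarrow> contained m2 m1 \<and> m2 \<noteq> m1"

definition complement_minor :: "minor \<Rightarrow> minor \<Rightarrow> minor" where
  "complement_minor m1 m2 = (fst m1 - fst m2, snd m1 - snd m2)"

definition removed_terms :: "'a::field itself \<Rightarrow> minor \<Rightarrow> minor \<Rightarrow> monomial set" where
  "removed_terms (_ :: 'a itself) m1 m2 =
     {t + t' | t t'. t \<in> Poly_Mapping.keys (minor_poly m2 :: 'a polynomial) \<and>
                     t' \<in> Poly_Mapping.keys (minor_poly (complement_minor m1 m2) :: 'a polynomial)}"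

definition removed_terms_set :: "'a::field itself \<Rightarrow> minor \<Rightarrow> minor set \<Rightarrow> monomial set" where
  "removed_terms_set K m M = (\<Union>f \<in> M. removed_terms K m f)"


section \<open>Permutations and elusive minors\<close>

text \<open>
  The permutation matrix has its 1 in row i at column w i. The entries are taken in the
  rationals, as the rank of a partial permutation matrix does not depend on the field.
\<close>

definition perm_nw_mat :: "(nat \<Rightarrow> nat) \<Rightarrow> nat \<Rightarrow> nat \<Rightarrow> rat mat" where
  "perm_nw_mat w p q = mat p q (\<lambda>(a, b). if w (a + 1) = b + 1 then 1 else 0)"

definition rk :: "(nat \<Rightarrow> nat) \<Rightarrow> nat \<Rightarrow> nat \<Rightarrow> nat" where
  "rk w p q = vec_space.rank p (perm_nw_mat w p q)"

definition rothe_diagram :: "nat \<Rightarrow> (nat \<Rightarrow> nat) \<Rightarrow> (nat \<times> nat) set" where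
  "rothe_diagram n w = {1..n} \<times> {1..n} -
     (\<Union>i \<in> {1..n}. {(i, w i)} \<union> {(k, w i) | k. k > i} \<union> {(i, l) | l. l > w i})"

definition ess :: "nat \<Rightarrow> (nat \<Rightarrow> nat) \<Rightarrow> (nat \<times> nat) set" where
  "ess n w = {(p, q) \<in> rothe_diagram n w.
     (p, q + 1) \<notin> rothe_diagram n w \<and> (p + 1, q) \<notin> rothe_diagram n w}"

definition vexillary :: "nat \<Rightarrow> (nat \<Rightarrow> nat) \<Rightarrow> bool" where
  "vexillary n w \<longleftrightarrow> \<not> (\<exists>i j k l. 1 \<le> i \<and> i < j \<and> j < k \<and> k < l \<and> l \<le> n \<and>
     w j < w i \<and> w i < w l \<and> w l < w k)"

definition fulton_generator :: "nat \<Rightarrow> (nat \<Rightarrow> nat) \<Rightarrow> nat \<times> nat \<Rightarrow> minor \<Rightarrow> bool" where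
  "fulton_generator n w = (\<lambda>(p, q) m. (p, q) \<in> ess n w \<and> m \<in> minors p q (rk w p q + 1))"

text \<open>\<open>attends w (p, q) m (p', q')\<close>: the generator m for (p, q) attends the northwest
  \<open>p' \<times> q'\<close> submatrix of the generic matrix.\<close>

definition attends :: "(nat \<Rightarrow> nat) \<Rightarrow> nat \<times> nat \<Rightarrow> minor \<Rightarrow> nat \<times> nat \<Rightarrow> bool" where
  "attends w = (\<lambda>(p, q) (R, C) (p', q').
     card (R \<inter> {1..p'}) \<ge> rk w p' q' + 1 \<and> card (C \<inter> {1..q'}) = rk w p q + 1 \<or>
     card (R \<inter> {1..p'}) = rk w p q + 1 \<and> card (C \<inter> {1..q'}) \<ge> rk w p' q' + 1)"

text \<open>
  The same minor can be a Fulton generator for several essential boxes. These have equal ranks,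
  so whether the condition below holds does not depend on the choice of the box.
\<close>

definition elusive :: "nat \<Rightarrow> (nat \<Rightarrow> nat) \<Rightarrow> minor \<Rightarrow> bool" where
  "elusive n w m \<longleftrightarrow> (\<exists>p q. fulton_generator n w (p, q) m \<and>
     (\<forall>(p', q') \<in> ess n w - {(p, q)}.
        rk w p' q' < rk w p q \<longrightarrow> \<not> attends w (p, q) m (p', q')))"

definition elusive_below :: "nat \<Rightarrow> (nat \<Rightarrow> nat) \<Rightarrow> minor \<Rightarrow> minor set" where
  "elusive_below n w m = {f. elusive n w f \<and> strictly_contained f m}"

end

theory Submission
  imports Defs
begin

text \<open>
  The terms of a minor \<open>m\<close> with rows \<open>R\<close> and columns \<open>C\<close> are the monomials of the bijections from \<open>R\<close> to
  \<open>C\<close>, here called matchings. A minor \<open>f\<close> with rows \<open>A\<close> and columns \<open>B\<close> partitions the matchings that map \<open>A\<close> onto \<open>B\<close> into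
  tiles: two of them are in the same tile if they agree outside \<open>A\<close>. By the sign rule of the
  Laplace expansion, the part of \<open>m\<close> belonging to a tile is a monomial times \<open>f\<close>, up to sign, so one reduction
  step by \<open>f\<close> deletes a tile as long as all its terms are still present with their original
  coefficients (\<open>red_step_removes_tile\<close>).

  The removed terms are the union of all tiles of the elusive minors strictly contained in \<open>m\<close>. These tiles
  may overlap, and deleting one of them may destroy another. The heart of the proof is that the set of removed
  terms is nevertheless a \<^emph>\<open>disjoint\<close> union of such tiles, which can then be deleted one after the other. It has
  two parts.

  First, a matching is removed if and only if it has at least \<open>rk w p q + 1\<close> entries in some
  essential box \<open>(p, q)\<close> whose Fulton generators are smaller than \<open>m\<close>. Assign to it
  a lowest such box and the right number of its entries there. Permuting these entries among themselves
  can only affect the number of entries in boxes that end further up, so the whole tile gets the same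
  assignment, and the tiles of the assigned Fulton generators are disjoint
  (\<open>crowded_matchings_tiled\<close>).

  Second, the assigned Fulton generators need not be elusive. One that is not elusive attends a box of smaller
  rank, and the Laplace expansion along its rows or columns in that box refines its tile to disjoint tiles of smaller
  Fulton generators; iterating this ends with elusive minors (\<open>fulton_generator_tile_tiled\<close>).

  No further reduction is possible: if the leading term of an elusive minor inside \<open>m\<close>, being one of its terms,
  divides a term of \<open>m\<close>, then that term is a removed one.
\<close>

section \<open>Matchings of rows with columns\<close>

definition graph_term :: "nat set \<Rightarrow> (nat \<Rightarrow> nat) \<Rightarrow> monomial" where
  "graph_term A \<sigma> = (\<Sum>i\<in>A. Poly_Mapping.single (i, \<sigma> i) 1)"

text \<open>
  The terms of the minor with rows \<open>R\<close> and columns \<open>C\<close> correspond to the bijections from \<open>R\<close> to \<open>C\<close>.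
  Fixing their values outside \<open>R\<close> makes this correspondence one-to-one; it is preserved by composition
  with permutations of subsets of \<open>R\<close>, as these do not move anything outside \<open>R\<close>.
\<close>

definition matchings :: "nat set \<Rightarrow> nat set \<Rightarrow> (nat \<Rightarrow> nat) set" where
  "matchings R C = {\<sigma> \<in> extensional R. bij_betw \<sigma> R C}"

lemma lookup_graph_term:
  assumes "finite A"
  shows "Poly_Mapping.lookup (graph_term A \<sigma>) (i, j) = (if i \<in> A \<and> j = \<sigma> i then 1 else 0)"
proof -
  have "Poly_Mapping.lookup (graph_term A \<sigma>) (i, j) = (\<Sum>k\<in>A. if k = i then (if j = \<sigma> i then 1 else 0) else 0)"
    unfolding graph_term_def lookup_sum
    by (intro sum.cong) (auto simp: lookup_single when_def)
  then show ?thesis using assms by simp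
qed

lemma graph_term_eqD:
  assumes "graph_term A \<sigma> = graph_term A \<tau>" "finite A" "i \<in> A"
  shows "\<sigma> i = \<tau> i"
proof -
  have "Poly_Mapping.lookup (graph_term A \<sigma>) (i, \<sigma> i) = Poly_Mapping.lookup (graph_term A \<tau>) (i, \<sigma> i)"
    using assms(1) by simp
  then show ?thesis using assms(2,3) by (simp add: lookup_graph_term split: if_splits)
qed

lemma graph_term_agree:
  assumes "graph_term R \<sigma> = graph_term A \<tau> + u" "finite R" "finite A" "i \<in> A"
  shows "\<sigma> i = \<tau> i"
proof -
  have "Poly_Mapping.lookup (graph_term R \<sigma>) (i, \<tau> i)
      = Poly_Mapping.lookup (graph_term A \<tau>) (i, \<tau> i) + Poly_Mapping.lookup u (i, \<tau> i)"
    by (simp add: assms(1) lookup_add)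
  then show ?thesis using assms(2-4) by (simp add: lookup_graph_term split: if_splits)
qed

lemma graph_term_cong: "(\<And>i. i \<in> A \<Longrightarrow> \<sigma> i = \<tau> i) \<Longrightarrow> graph_term A \<sigma> = graph_term A \<tau>"
  unfolding graph_term_def by (intro sum.cong) auto

lemma inj_on_graph_term:
  assumes "finite R"
  shows "inj_on (graph_term R) (matchings R C)"
  using graph_term_eqD[OF _ assms] unfolding matchings_def
  by (intro inj_onI) (auto intro: extensionalityI)

lemma graph_term_split:
  assumes "finite R" "A \<subseteq> R"
  shows "graph_term R \<sigma> = graph_term A \<sigma> + graph_term (R - A) \<sigma>"
  unfolding graph_term_def
  using sum.subset_diff[OF assms(2,1), of "\<lambda>i. Poly_Mapping.single (i, \<sigma> i) (1::nat)"]
  by (simp add: add.commute)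

lemma finite_matchings: "finite R \<Longrightarrow> finite C \<Longrightarrow> finite (matchings R C)"
  by (rule finite_subset[OF _ finite_PiE[of R "\<lambda>_. C"]]) (auto simp: matchings_def PiE_def dest: bij_betwE)

lemma matchings_comp_permutes:
  assumes "\<sigma> \<in> matchings R C" "\<rho> permutes A" "A \<subseteq> R"
  shows "\<sigma> \<circ> \<rho> \<in> matchings R C"
proof -
  have p: "\<rho> permutes R" using assms by (blast intro: permutes_subset)
  then show ?thesis using assms(1) bij_betw_trans[OF permutes_imp_bij[OF p]]
    by (auto simp: matchings_def extensional_def permutes_not_in)
qed

lemma bij_betw_submatching:
  assumes "\<sigma> \<in> matchings R C" "A \<subseteq> R" "\<sigma> ` A = B"
  shows "bij_betw \<sigma> A B" "bij_betw \<sigma> (R - A) (C - B)"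
proof -
  have b: "bij_betw \<sigma> R C" using assms(1) by (simp add: matchings_def)
  show 1: "bij_betw \<sigma> A B" using bij_betw_subset[OF b assms(2,3)] .
  have "\<sigma> ` (R - A) = C - B" using b assms(2,3) by (auto simp: bij_betw_def inj_on_def)
  then show "bij_betw \<sigma> (R - A) (C - B)" using bij_betw_subset[OF b Diff_subset] by blast
qed

lemma restrict_in_matchings:
  assumes "bij_betw \<sigma> A B"
  shows "restrict \<sigma> A \<in> matchings A B" "graph_term A (restrict \<sigma> A) = graph_term A \<sigma>"
proof -
  have "bij_betw (restrict \<sigma> A) A B \<longleftrightarrow> bij_betw \<sigma> A B" by (rule bij_betw_cong) simp
  then show "restrict \<sigma> A \<in> matchings A B" using assms by (simp add: matchings_def)
  show "graph_term A (restrict \<sigma> A) = graph_term A \<sigma>" by (rule graph_term_cong) simp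
qed

section \<open>The coefficients of a minor\<close>

lemma prod_single_one:
  "(\<Prod>i\<in>I. Poly_Mapping.single (s i) (1 :: 'a::comm_ring_1)) = Poly_Mapping.single (\<Sum>i\<in>I. s i) 1"
  by (induction I rule: infinite_finite_induct) (simp_all add: mult_single)

lemma of_int_sign_mult_single:
  "of_int (sign p) * Poly_Mapping.single t (c :: 'a::comm_ring_1)
     = Poly_Mapping.single t (of_int (sign p) * c)"
  by (cases p rule: sign_cases) (simp_all add: single_uminus)

text \<open>
  Expanding around an arbitrary matching \<open>\<sigma>\<close>, rather than around the order-preserving one, makes visible
  that relative signs depend only on the permutation \<open>\<pi>\<close> of the rows: this is the only information
  about signs needed later. In particular it contains the sign rule of the Laplace expansion, since a
  permutation of a set of rows has the same sign in a minor and in its subminors.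
\<close>

lemma minor_poly_expansion:
  fixes \<sigma> :: "nat \<Rightarrow> nat"
  assumes fin: "finite R" and bij: "bij_betw \<sigma> R C"
  shows "\<exists>\<epsilon>\<in>{1, -1 :: 'a::comm_ring_1}. minor_poly (R, C) = (\<Sum>\<pi> | \<pi> permutes R.
           Poly_Mapping.single (graph_term R (\<sigma> \<circ> \<pi>)) (\<epsilon> * of_int (sign \<pi>)))"
proof -
  define k where "k = card R"
  have finC: "finite C" and cC: "card C = k"
    using fin bij_betw_finite[OF bij] bij_betw_same_card[OF bij] by (simp_all add: k_def)
  define f where "f = (\<lambda>i. sorted_list_of_set R ! i)"
  define g where "g = (\<lambda>i. sorted_list_of_set C ! i)"
  let ?I = "{0..<k}"
  have f: "bij_betw f ?I R"
    using fin unfolding f_def k_def by (intro bij_betw_nth) auto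
  have g: "bij_betw g ?I C"
    using finC cC unfolding g_def by (intro bij_betw_nth) auto
  \<comment> \<open>Read through the sorted enumerations \<open>f\<close> of the rows and \<open>g\<close> of the columns, \<open>\<sigma>\<close> is the
    permutation \<open>p0\<close> of the positions; its sign is the global sign \<open>\<epsilon>\<close>.\<close>
  define p0 where "p0 i = (if i \<in> ?I then inv_into ?I g (\<sigma> (f i)) else i)" for i
  have "bij_betw (inv_into ?I g \<circ> (\<sigma> \<circ> f)) ?I ?I"
    by (rule bij_betw_trans[OF bij_betw_trans[OF f bij] bij_betw_inv_into[OF g]])
  moreover have "bij_betw p0 ?I ?I \<longleftrightarrow> bij_betw (inv_into ?I g \<circ> (\<sigma> \<circ> f)) ?I ?I"
    by (rule bij_betw_cong) (simp add: p0_def)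
  ultimately have "bij_betw p0 ?I ?I" by blast
  then have p0: "p0 permutes ?I" by (rule bij_imp_permutes) (auto simp: p0_def)
  have gp0: "g (p0 i) = \<sigma> (f i)" if "i < k" for i
  proof -
    have "\<sigma> (f i) \<in> C" using that bij_betwE[OF f] bij_betwE[OF bij] by auto
    then show ?thesis using that bij_betw_inv_into_right[OF g] by (simp add: p0_def)
  qed
  \<comment> \<open>Transporting along \<open>f\<close> identifies permutations of positions with permutations of rows and keeps signs.\<close>
  define T where "T q = map_permutation ?I f q" for q
  have T: "bij_betw T {q. q permutes ?I} {\<pi>. \<pi> permutes R}"
  proof -
    have "T q = (\<lambda>x. if x \<in> R then f (q (inv_into ?I f x)) else x)" for q
      using f by (auto simp: T_def map_permutation_def restrict_id_def fun_eq_iff bij_betw_def)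
    then have "T = (\<lambda>q x. if x \<in> R then f (q (inv_into ?I f x)) else x)" by (rule ext)
    then show ?thesis using bij_betw_permutations[OF f] by simp
  qed
  let ?s = "\<lambda>p. of_int (sign p) :: 'a"
  have "(minor_poly (R, C) :: 'a polynomial)
      = (\<Sum>p | p permutes ?I. of_int (sign p) * (\<Prod>i = 0..<k. var (f i) (g (p i))))"
  proof -
    have "(minor_poly (R, C) :: 'a polynomial) = det (mat k k (\<lambda>(a, b). var (f a) (g b)))"
      unfolding minor_poly_def f_def g_def by (simp add: cC k_def)
    also have "\<dots> = (\<Sum>p | p permutes ?I. of_int (sign p)
        * (\<Prod>i = 0..<k. mat k k (\<lambda>(a, b). var (f a) (g b)) $$ (i, p i)))"
      by (rule det_def') simp
    also have "\<dots> = (\<Sum>p | p permutes ?I. of_int (sign p) * (\<Prod>i = 0..<k. var (f i) (g (p i))))"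
    proof (intro sum.cong refl arg_cong2[where f = "(*)"] prod.cong)
      fix p i assume "p \<in> {p. p permutes ?I}" "i \<in> {0..<k}"
      then have "i < k" "p i < k" using permutes_in_image[of p ?I i] by auto
      then show "mat k k (\<lambda>(a, b). var (f a) (g b)) $$ (i, p i) = (var (f i) (g (p i)) :: 'a polynomial)"
        by simp
    qed
    finally show ?thesis .
  qed
  also have "\<dots> = (\<Sum>p | p permutes ?I.
      Poly_Mapping.single (\<Sum>i\<in>?I. Poly_Mapping.single (f i, g (p i)) 1) (?s p))"
    by (simp add: var_def prod_single_one of_int_sign_mult_single)
  also have "\<dots> = (\<Sum>q | q permutes ?I.
      Poly_Mapping.single (\<Sum>i\<in>?I. Poly_Mapping.single (f i, g ((p0 \<circ> q) i)) 1) (?s (p0 \<circ> q)))"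
    by (rule setum_permutations_compose_left[OF p0])
  also have "\<dots> = (\<Sum>q | q permutes ?I.
      Poly_Mapping.single (graph_term R (\<sigma> \<circ> T q)) (?s p0 * of_int (sign (T q))))"
  proof (intro sum.cong refl)
    fix q assume "q \<in> {q. q permutes ?I}"
    then have q: "q permutes ?I" by simp
    have "graph_term R (\<sigma> \<circ> T q) = (\<Sum>i\<in>?I. Poly_Mapping.single (f i, \<sigma> (T q (f i))) 1)"
      unfolding graph_term_def using sum.reindex_bij_betw[OF f, symmetric] by simp
    also have "\<dots> = (\<Sum>i\<in>?I. Poly_Mapping.single (f i, g ((p0 \<circ> q) i)) 1)"
    proof (intro sum.cong refl)
      fix i assume i: "i \<in> ?I"
      then have "q i \<in> ?I" using permutes_in_image[OF q] by blast
      moreover have "T q (f i) = f (q i)"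
        unfolding T_def using f i by (intro map_permutation_apply) (auto simp: bij_betw_def)
      ultimately show "Poly_Mapping.single (f i, \<sigma> (T q (f i))) (1::nat)
          = Poly_Mapping.single (f i, g ((p0 \<circ> q) i)) 1"
        using gp0 by simp
    qed
    finally have "graph_term R (\<sigma> \<circ> T q) = (\<Sum>i\<in>?I. Poly_Mapping.single (f i, g ((p0 \<circ> q) i)) 1)" .
    moreover have "sign (p0 \<circ> q) = sign p0 * sign q"
      by (intro sign_compose permutes_imp_permutation[OF _ p0] permutes_imp_permutation[OF _ q]) auto
    moreover have "sign (T q) = sign q"
      unfolding T_def using f q by (intro sign_map_permutation) (auto simp: bij_betw_def)
    ultimately show "Poly_Mapping.single (\<Sum>i\<in>?I. Poly_Mapping.single (f i, g ((p0 \<circ> q) i)) 1) (?s (p0 \<circ> q))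
       = Poly_Mapping.single (graph_term R (\<sigma> \<circ> T q)) (?s p0 * of_int (sign (T q)))"
      by simp
  qed
  also have "\<dots> = (\<Sum>\<pi> | \<pi> permutes R.
      Poly_Mapping.single (graph_term R (\<sigma> \<circ> \<pi>)) (?s p0 * of_int (sign \<pi>)))"
    using sum.reindex_bij_betw[OF T] by simp
  finally have "minor_poly (R, C) = \<dots>" .
  moreover have "?s p0 \<in> {1, -1}" by (cases p0 rule: sign_cases) auto
  ultimately show ?thesis by (rule bexI)
qed

text \<open>
  The coefficients can be read off because different permutations give different terms.
\<close>

lemma lookup_minor_poly:
  fixes \<sigma> :: "nat \<Rightarrow> nat"
  assumes fin: "finite R" and bij: "bij_betw \<sigma> R C"
  shows "\<exists>\<epsilon>\<in>{1, -1 :: 'a::comm_ring_1}.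
    minor_poly (R, C) = (\<Sum>\<pi> | \<pi> permutes R.
           Poly_Mapping.single (graph_term R (\<sigma> \<circ> \<pi>)) (\<epsilon> * of_int (sign \<pi>))) \<and>
    (\<forall>\<rho>. \<rho> permutes R \<longrightarrow>
      Poly_Mapping.lookup (minor_poly (R, C)) (graph_term R (\<sigma> \<circ> \<rho>)) = \<epsilon> * of_int (sign \<rho>))"
proof -
  obtain \<epsilon> :: 'a where e: "\<epsilon> \<in> {1, -1}" and
    M: "minor_poly (R, C) = (\<Sum>\<pi> | \<pi> permutes R.
           Poly_Mapping.single (graph_term R (\<sigma> \<circ> \<pi>)) (\<epsilon> * of_int (sign \<pi>)))"
    by (rule bexE[OF minor_poly_expansion[OF fin bij]])
  have "Poly_Mapping.lookup (minor_poly (R, C)) (graph_term R (\<sigma> \<circ> \<rho>)) = \<epsilon> * of_int (sign \<rho>)"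
    if r: "\<rho> permutes R" for \<rho>
  proof -
    have "\<pi> = \<rho>" if p: "\<pi> permutes R" and eq: "graph_term R (\<sigma> \<circ> \<pi>) = graph_term R (\<sigma> \<circ> \<rho>)" for \<pi>
    proof
      fix i
      show "\<pi> i = \<rho> i"
      proof (cases "i \<in> R")
        case True
        then have "\<sigma> (\<pi> i) = \<sigma> (\<rho> i)" using graph_term_eqD[OF eq fin] by simp
        then show ?thesis using bij True p r by (metis bij_betw_imp_inj_on inj_onD permutes_in_image)
      qed (use p r in \<open>simp add: permutes_not_in\<close>)
    qed
    then have "Poly_Mapping.lookup (minor_poly (R, C)) (graph_term R (\<sigma> \<circ> \<rho>))
      = (\<Sum>\<pi> | \<pi> permutes R. if \<pi> = \<rho> then \<epsilon> * of_int (sign \<rho>) else 0)"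
      unfolding M lookup_sum by (intro sum.cong) (auto simp: lookup_single when_def)
    then show ?thesis using r finite_permutations[OF fin] by simp
  qed
  with e M show ?thesis by (intro bexI[of _ \<epsilon>]) auto
qed

lemma
  fixes R C :: "nat set" and \<sigma> :: "nat \<Rightarrow> nat"
  defines "c \<equiv> \<lambda>\<sigma>. Poly_Mapping.lookup (minor_poly (R, C) :: 'a::comm_ring_1 polynomial) (graph_term R \<sigma>)"
  assumes "finite R" "bij_betw \<sigma> R C"
  shows coeff_minor_poly: "c \<sigma> \<in> {1, -1}"
    and coeff_minor_poly_comp: "\<rho> permutes R \<Longrightarrow> c (\<sigma> \<circ> \<rho>) = of_int (sign \<rho>) * c \<sigma>"
    and minor_poly_eq_sum: "minor_poly (R, C) = (\<Sum>\<pi> | \<pi> permutes R.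
      Poly_Mapping.single (graph_term R (\<sigma> \<circ> \<pi>)) (of_int (sign \<pi>) * c \<sigma>))"
proof -
  obtain \<epsilon> :: 'a where e: "\<epsilon> \<in> {1, -1}" and
    M: "minor_poly (R, C) = (\<Sum>\<pi> | \<pi> permutes R.
      Poly_Mapping.single (graph_term R (\<sigma> \<circ> \<pi>)) (\<epsilon> * of_int (sign \<pi>)))" and
    l: "\<forall>\<rho>. \<rho> permutes R \<longrightarrow> c (\<sigma> \<circ> \<rho>) = \<epsilon> * of_int (sign \<rho>)"
    unfolding c_def by (rule bexE[OF lookup_minor_poly[OF assms(2,3)]]) (erule conjE)
  have c: "c \<sigma> = \<epsilon>" using l[rule_format, OF permutes_id] by simp
  show "c \<sigma> \<in> {1, -1}" using e c by simp
  show "c (\<sigma> \<circ> \<rho>) = of_int (sign \<rho>) * c \<sigma>" if "\<rho> permutes R"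
    using l that c by (simp add: mult.commute)
  show "minor_poly (R, C) = (\<Sum>\<pi> | \<pi> permutes R.
      Poly_Mapping.single (graph_term R (\<sigma> \<circ> \<pi>)) (of_int (sign \<pi>) * c \<sigma>))"
    unfolding c M by (simp add: mult.commute)
qed

lemma keys_minor_poly:
  assumes fin: "finite R" "finite C" and card: "card R = card C"
  shows "Poly_Mapping.keys (minor_poly (R, C) :: 'a::comm_ring_1 polynomial) = graph_term R ` matchings R C"
proof
  obtain \<sigma> where s: "bij_betw \<sigma> R C" using fin card finite_same_card_bij by blast
  obtain \<epsilon> :: 'a where 
    M: "minor_poly (R, C) = (\<Sum>\<pi> | \<pi> permutes R.
           Poly_Mapping.single (graph_term R (\<sigma> \<circ> \<pi>)) (\<epsilon> * of_int (sign \<pi>)))"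
    by (rule bexE[OF minor_poly_expansion[OF fin(1) s]])
  show "Poly_Mapping.keys (minor_poly (R, C) :: 'a polynomial) \<subseteq> graph_term R ` matchings R C"
  proof
    fix t assume "t \<in> Poly_Mapping.keys (minor_poly (R, C) :: 'a polynomial)"
    then obtain \<pi> where p: "\<pi> permutes R" and t: "t = graph_term R (\<sigma> \<circ> \<pi>)"
      unfolding M using keys_sum by (fastforce split: if_splits)
    have "bij_betw (\<sigma> \<circ> \<pi>) R C" using bij_betw_trans[OF permutes_imp_bij[OF p] s] .
    moreover have "bij_betw (restrict (\<sigma> \<circ> \<pi>) R) R C \<longleftrightarrow> bij_betw (\<sigma> \<circ> \<pi>) R C"
      by (rule bij_betw_cong) simp
    ultimately have "restrict (\<sigma> \<circ> \<pi>) R \<in> matchings R C"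
      unfolding matchings_def by simp
    moreover have "t = graph_term R (restrict (\<sigma> \<circ> \<pi>) R)" unfolding t by (intro graph_term_cong) simp
    ultimately show "t \<in> graph_term R ` matchings R C" by blast
  qed
  show "graph_term R ` matchings R C \<subseteq> Poly_Mapping.keys (minor_poly (R, C) :: 'a polynomial)"
  proof clarify
    fix \<sigma> assume "\<sigma> \<in> matchings R C"
    then have "bij_betw \<sigma> R C" by (simp add: matchings_def)
    then have "Poly_Mapping.lookup (minor_poly (R, C) :: 'a polynomial) (graph_term R \<sigma>) \<in> {1, -1}"
      by (rule coeff_minor_poly[OF fin(1)])
    then show "graph_term R \<sigma> \<in> Poly_Mapping.keys (minor_poly (R, C) :: 'a polynomial)"
      by (auto simp: in_keys_iff)
  qed
qed

definition part_poly :: "minor \<Rightarrow> (nat \<Rightarrow> nat) set \<Rightarrow> 'a::comm_ring_1 polynomial" where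
  "part_poly m X = (\<Sum>\<sigma>\<in>X. Poly_Mapping.single (graph_term (fst m) \<sigma>)
     (Poly_Mapping.lookup (minor_poly m) (graph_term (fst m) \<sigma>)))"

lemma keys_part_poly: "Poly_Mapping.keys (part_poly m X :: 'a::comm_ring_1 polynomial) \<subseteq> graph_term (fst m) ` X"
proof -
  have "Poly_Mapping.keys (part_poly m X :: 'a polynomial) \<subseteq> (\<Union>\<sigma>\<in>X. Poly_Mapping.keys (Poly_Mapping.single
      (graph_term (fst m) \<sigma>) (Poly_Mapping.lookup (minor_poly m :: 'a polynomial) (graph_term (fst m) \<sigma>))))"
    unfolding part_poly_def by (rule keys_sum)
  also have "\<dots> \<subseteq> graph_term (fst m) ` X" by (auto split: if_splits)
  finally show ?thesis .
qed

lemma sum_single_lookup: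
  assumes "finite K" "Poly_Mapping.keys P \<subseteq> K"
  shows "(\<Sum>t\<in>K. Poly_Mapping.single t (Poly_Mapping.lookup P t)) = P"
proof (rule poly_mapping_eqI)
  fix t
  have "Poly_Mapping.lookup (\<Sum>t\<in>K. Poly_Mapping.single t (Poly_Mapping.lookup P t)) t
    = (\<Sum>s\<in>K. if s = t then Poly_Mapping.lookup P t else 0)"
    unfolding lookup_sum by (intro sum.cong) (auto simp: lookup_single when_def)
  also have "\<dots> = Poly_Mapping.lookup P t" using assms by (auto simp: in_keys_iff)
  finally show "Poly_Mapping.lookup (\<Sum>t\<in>K. Poly_Mapping.single t (Poly_Mapping.lookup P t)) t
    = Poly_Mapping.lookup P t" .
qed

lemma part_poly_matchings:
  assumes "finite R" "finite C" "card R = card C"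
  shows "part_poly (R, C) (matchings R C) = (minor_poly (R, C) :: 'a::comm_ring_1 polynomial)"
proof -
  have "part_poly (R, C) (matchings R C) = (\<Sum>t\<in>graph_term R ` matchings R C.
      Poly_Mapping.single t (Poly_Mapping.lookup (minor_poly (R, C) :: 'a polynomial) t))"
    unfolding part_poly_def by (simp add: sum.reindex[OF inj_on_graph_term[OF assms(1)]])
  then show ?thesis
    using sum_single_lookup[of "graph_term R ` matchings R C" "minor_poly (R, C) :: 'a polynomial"]
      finite_matchings[OF assms(1,2)] keys_minor_poly[OF assms] by auto
qed

lemma lookup_part_poly:
  assumes "finite R" "finite C" "X \<subseteq> matchings R C" "\<sigma> \<in> X"
  shows "Poly_Mapping.lookup (part_poly (R, C) X :: 'a::comm_ring_1 polynomial) (graph_term R \<sigma>)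
    = Poly_Mapping.lookup (minor_poly (R, C)) (graph_term R \<sigma>)"
proof -
  have finX: "finite X" using finite_subset assms(3) finite_matchings[OF assms(1,2)] by blast
  have "Poly_Mapping.lookup (part_poly (R, C) X :: 'a polynomial) (graph_term R \<sigma>)
    = (\<Sum>\<tau>\<in>X. if \<tau> = \<sigma> then Poly_Mapping.lookup (minor_poly (R, C)) (graph_term R \<sigma>) else 0)"
    unfolding part_poly_def lookup_sum using inj_onD[OF inj_on_graph_term[OF assms(1), of C]] assms(3,4)
    by (intro sum.cong) (auto simp: lookup_single when_def)
  then show ?thesis using finX assms(4) by simp
qed

lemma part_poly_Diff:
  assumes "finite X" "Y \<subseteq> X"
  shows "part_poly m X = part_poly m Y + part_poly m (X - Y)"
  unfolding part_poly_def using sum.subset_diff[OF assms(2,1)] by (simp add: add.commute)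

text \<open>
  If \<open>\<sigma>\<close> maps \<open>A\<close> onto \<open>B\<close>, its monomial splits into the parts over \<open>A\<close> and over \<open>R - A\<close>, which are terms of
  the two complementary minors. Conversely, a monomial determines its matching, so any such
  factorization forces \<open>\<sigma>\<close> to agree on \<open>A\<close> with a matching of \<open>A\<close> with \<open>B\<close>.
\<close>

lemma graph_term_removed_iff:
  assumes "finite R" "finite C" "\<sigma> \<in> matchings R C" "A \<subseteq> R" "B \<subseteq> C" "card A = card B"
  shows "graph_term R \<sigma> \<in> removed_terms TYPE('a::field) (R, C) (A, B) \<longleftrightarrow> \<sigma> ` A = B"
proof -
  have fin: "finite A" "finite B" using assms finite_subset by blast+
  note k1 = keys_minor_poly[OF fin assms(6), where ?'a = 'a]
  have cRC: "card R = card C" using assms(3) bij_betw_same_card by (auto simp: matchings_def)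
  have "card (R - A) = card (C - B)" using cRC assms fin by (simp add: card_Diff_subset)
  then have k2: "Poly_Mapping.keys (minor_poly (R - A, C - B) :: 'a polynomial)
      = graph_term (R - A) ` matchings (R - A) (C - B)"
    using assms(1,2) by (intro keys_minor_poly) auto
  show ?thesis
  proof
    assume "graph_term R \<sigma> \<in> removed_terms TYPE('a) (R, C) (A, B)"
    then obtain \<tau> u where t: "\<tau> \<in> matchings A B" "graph_term R \<sigma> = graph_term A \<tau> + u"
      unfolding removed_terms_def k1 by blast
    then have "\<sigma> ` A = \<tau> ` A"
      using graph_term_agree[OF t(2) assms(1) fin(1)] by (intro image_cong) auto
    then show "\<sigma> ` A = B" using t(1) by (simp add: matchings_def bij_betw_def)
  next
    assume "\<sigma> ` A = B"
    note b = bij_betw_submatching[OF assms(3,4) this]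
    have "graph_term A \<sigma> \<in> graph_term A ` matchings A B"
      using restrict_in_matchings[OF b(1)] by (metis image_eqI)
    moreover have "graph_term (R - A) \<sigma> \<in> graph_term (R - A) ` matchings (R - A) (C - B)"
      using restrict_in_matchings[OF b(2)] by (metis image_eqI)
    ultimately show "graph_term R \<sigma> \<in> removed_terms TYPE('a) (R, C) (A, B)"
      unfolding removed_terms_def k1 complement_minor_def fst_conv snd_conv k2
      using graph_term_split[OF assms(1,4)] by blast
  qed
qed

section \<open>Tilings of sets of matchings\<close>

text \<open>
  The left coset of the symmetric group of \<open>A\<close>: the matchings that arise from \<open>\<sigma>\<close> by permuting its values on
  \<open>A\<close>. Its terms are those of the minor \<open>(A, \<sigma> ` A)\<close>, each multiplied by the term of \<open>\<sigma>\<close> on the other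
  rows, so a tile is exactly what one reduction step by that minor can cancel.
\<close>

definition tile :: "(nat \<Rightarrow> nat) \<Rightarrow> nat set \<Rightarrow> (nat \<Rightarrow> nat) set" where
  "tile \<sigma> A = {\<sigma> \<circ> \<rho> | \<rho>. \<rho> permutes A}"

lemma self_in_tile: "\<sigma> \<in> tile \<sigma> A"
  unfolding tile_def using permutes_id[of A] by (auto intro!: exI[of _ id])

lemma tile_image:
  assumes "\<tau> \<in> tile \<sigma> A"
  shows "\<tau> ` A = \<sigma> ` A"
proof -
  obtain \<rho> where "\<rho> permutes A" "\<tau> = \<sigma> \<circ> \<rho>" using assms unfolding tile_def by blast
  then show ?thesis by (simp only: image_comp[symmetric] permutes_image)
qed

lemma tile_subset_tile:
  assumes "\<tau> \<in> tile \<sigma> A" "B \<subseteq> A"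
  shows "tile \<tau> B \<subseteq> tile \<sigma> A"
proof
  fix \<upsilon> assume "\<upsilon> \<in> tile \<tau> B"
  then obtain \<rho>' where r': "\<rho>' permutes B" "\<upsilon> = \<tau> \<circ> \<rho>'" unfolding tile_def by blast
  obtain \<rho> where r: "\<rho> permutes A" "\<tau> = \<sigma> \<circ> \<rho>" using assms(1) unfolding tile_def by blast
  have "\<rho>' permutes A" using r'(1) assms(2) by (rule permutes_subset)
  then have "\<rho> \<circ> \<rho>' permutes A" using r(1) by (rule permutes_compose)
  moreover have "\<upsilon> = \<sigma> \<circ> (\<rho> \<circ> \<rho>')" using r r' by (simp add: comp_assoc)
  ultimately show "\<upsilon> \<in> tile \<sigma> A" unfolding tile_def by blast
qed

lemma tile_sym:
  assumes "\<tau> \<in> tile \<sigma> A"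
  shows "\<sigma> \<in> tile \<tau> A"
proof -
  obtain \<rho> where r: "\<rho> permutes A" "\<tau> = \<sigma> \<circ> \<rho>" using assms unfolding tile_def by blast
  have "\<sigma> = \<tau> \<circ> inv_into UNIV \<rho>" using permutes_inv_o(1)[OF r(1)] r(2) by (simp add: comp_assoc)
  then show ?thesis unfolding tile_def using permutes_inv[OF r(1)] by blast
qed

lemma tile_eq: "\<tau> \<in> tile \<sigma> A \<Longrightarrow> tile \<tau> A = tile \<sigma> A"
  by (intro equalityI tile_subset_tile) (auto intro: tile_sym)

lemma tile_subset_matchings: "\<sigma> \<in> matchings R C \<Longrightarrow> A \<subseteq> R \<Longrightarrow> tile \<sigma> A \<subseteq> matchings R C"
  unfolding tile_def using matchings_comp_permutes by blast

text \<open>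
  Disjoint unions of finitely many tiles whose minors belong to \<open>F\<close>. Disjointness is essential: where two
  tiles overlap, cancelling both would bring the common terms back with the opposite sign.
\<close>

inductive tiled :: "minor set \<Rightarrow> nat set \<Rightarrow> (nat \<Rightarrow> nat) set \<Rightarrow> bool" for F R where
  empty: "tiled F R {}"
| insert: "tiled F R X \<Longrightarrow> A \<subseteq> R \<Longrightarrow> (A, \<sigma> ` A) \<in> F \<Longrightarrow> tile \<sigma> A \<inter> X = {} \<Longrightarrow> tiled F R (tile \<sigma> A \<union> X)"

lemma tiled_tile: "A \<subseteq> R \<Longrightarrow> (A, \<sigma> ` A) \<in> F \<Longrightarrow> tiled F R (tile \<sigma> A)"
  using tiled.insert[OF tiled.empty] by force

lemma tiled_Un:
  assumes "tiled F R X" "tiled F R Y" "X \<inter> Y = {}"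
  shows "tiled F R (X \<union> Y)"
  using assms(1,3)
proof induction
  case empty
  then show ?case using assms(2) by simp
next
  case (insert X A \<sigma>)
  then have "tiled F R (X \<union> Y)" "tile \<sigma> A \<inter> (X \<union> Y) = {}" by blast+
  then show ?case using tiled.insert[OF _ insert.hyps(2,3)] by (simp add: Un_assoc)
qed

lemma tiled_Union:
  assumes "finite \<X>" "disjoint \<X>" "\<And>X. X \<in> \<X> \<Longrightarrow> tiled F R X"
  shows "tiled F R (\<Union>\<X>)"
  using assms
proof (induction \<X> rule: finite_induct)
  case empty
  then show ?case by (simp add: tiled.empty)
next
  case (insert X \<X>)
  have "X \<inter> \<Union>\<X> = {}" using insert.hyps insert.prems(1) unfolding pairwise_def disjnt_def by auto
  moreover have "tiled F R (\<Union>\<X>)" using insert by (simp add: pairwise_insert)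
  ultimately show ?case using tiled_Un insert.prems(2) by simp
qed

text \<open>
  The source of all tilings. A rule \<open>sel\<close> assigns to each matching a set of rows; if the rule gives the same
  answer all over the tile that it selects, then the selected tiles are equivalence classes.
\<close>

lemma tiled_by_stable_choice:
  assumes "finite X"
    and tiles: "\<And>\<sigma>. \<sigma> \<in> X \<Longrightarrow> tile \<sigma> (sel \<sigma>) \<subseteq> X \<and> tiled F R (tile \<sigma> (sel \<sigma>))"
    and stable: "\<And>\<sigma> \<tau>. \<sigma> \<in> X \<Longrightarrow> \<tau> \<in> tile \<sigma> (sel \<sigma>) \<Longrightarrow> sel \<tau> = sel \<sigma>"
  shows "tiled F R X"
proof -
  let ?\<X> = "(\<lambda>\<sigma>. tile \<sigma> (sel \<sigma>)) ` X"
  have eq: "tile \<tau> (sel \<tau>) = tile \<sigma> (sel \<sigma>)" if "\<sigma> \<in> X" "\<tau> \<in> tile \<sigma> (sel \<sigma>)" for \<sigma> \<tau>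
    using that stable[OF that] tile_eq by simp
  have "disjoint ?\<X>"
  proof (rule pairwiseI)
    fix Y Z assume "Y \<in> ?\<X>" "Z \<in> ?\<X>" "Y \<noteq> Z"
    then show "disjnt Y Z" unfolding disjnt_def using eq by blast
  qed
  then have "tiled F R (\<Union>?\<X>)" using assms(1) tiles by (intro tiled_Union) auto
  moreover have "\<Union>?\<X> = X" using tiles self_in_tile by blast
  ultimately show ?thesis by simp
qed

lemma tiled_contains_minor:
  assumes "tiled F R X" "\<sigma> \<in> X"
  shows "\<exists>f\<in>F. \<sigma> ` fst f = snd f"
  using assms
proof induction
  case (insert X A \<sigma>')
  show ?case
  proof (cases "\<sigma> \<in> tile \<sigma>' A")
    case True
    then show ?thesis using insert.hyps(3) tile_image by (intro bexI[of _ "(A, \<sigma>' ` A)"]) auto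
  next
    case False
    then show ?thesis using insert.IH insert.prems by blast
  qed
qed simp

section \<open>Tiling the removed terms by elusive minors\<close>

text \<open>
  Fulton generators that are not elusive cannot be used for reduction, but their tiles break up into
  tiles of elusive ones. If the generator is not elusive, it attends a box of smaller rank; a Laplace
  expansion along rows, or columns, that lie in that box splits its tile into disjoint tiles
  of Fulton generators for that box. These are smaller, so induction on the size applies.
\<close>

lemma fulton_generator_tile_tiled:
  assumes "finite R" "finite C"
  shows "\<sigma> \<in> matchings R C \<Longrightarrow> A \<subseteq> R \<Longrightarrow> fulton_generator n w b (A, \<sigma> ` A) \<Longrightarrow> card A < card R
    \<Longrightarrow> tiled (elusive_below n w (R, C)) R (tile \<sigma> A)"
proof (induction "card A" arbitrary: A b \<sigma> rule: less_induct)
  case less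
  note \<sigma> = less.prems(1) and A = less.prems(2) and fulton = less.prems(3)
  obtain p q where b: "b = (p, q)" by fastforce
  have finA: "finite A" using A assms(1) finite_subset by blast
  have bij: "bij_betw \<sigma> R C" using \<sigma> by (simp add: matchings_def)
  have inj: "inj_on \<sigma> A" using bij A by (meson bij_betw_def inj_on_subset)
  have cA: "card A = rk w p q + 1" using fulton b by (simp add: fulton_generator_def minors_def)
  have Ap: "A \<subseteq> {1..p}" "\<sigma> ` A \<subseteq> {1..q}" using fulton b by (simp_all add: fulton_generator_def minors_def)
  show ?case
  proof (cases "elusive n w (A, \<sigma> ` A)")
    case True
    have "A \<noteq> R" using less.prems(4) by blast
    moreover have "\<sigma> ` A \<subseteq> C" using A bij by (auto simp: bij_betw_def)
    ultimately have "(A, \<sigma> ` A) \<in> elusive_below n w (R, C)"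
      using True A by (simp add: elusive_below_def strictly_contained_def contained_def)
    then show ?thesis by (rule tiled_tile[OF A])
  next
    case False
    then obtain p' q' where ess: "(p', q') \<in> ess n w" and rk: "rk w p' q' < rk w p q"
      and att: "attends w (p, q) (A, \<sigma> ` A) (p', q')"
      using fulton b unfolding elusive_def by blast
    \<comment> \<open>It suffices to choose, for each \<open>\<tau>\<close> in the tile, \<open>rk w p' q' + 1\<close> of its rows whose entries lie in the
      box \<open>(p', q')\<close>, in a way that rearranging \<open>\<tau>\<close> within the chosen rows does not affect.\<close>
    have step: "tiled (elusive_below n w (R, C)) R (tile \<sigma> A)"
      if sel: "\<And>\<tau>. \<tau> \<in> tile \<sigma> A \<Longrightarrow> sel \<tau> \<subseteq> A \<inter> {1..p'} \<and> \<tau> ` sel \<tau> \<subseteq> {1..q'} \<and> card (sel \<tau>) = rk w p' q' + 1"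
        and stable: "\<And>\<tau> \<upsilon>. \<tau> \<in> tile \<sigma> A \<Longrightarrow> \<upsilon> \<in> tile \<tau> (sel \<tau>) \<Longrightarrow> sel \<upsilon> = sel \<tau>" for sel
    proof (rule tiled_by_stable_choice[where sel = sel])
      show "finite (tile \<sigma> A)"
        using tile_subset_matchings[OF \<sigma> A] finite_matchings[OF assms] by (rule finite_subset)
      fix \<tau> assume t: "\<tau> \<in> tile \<sigma> A"
      have tM: "\<tau> \<in> matchings R C" using t tile_subset_matchings[OF \<sigma> A] by blast
      then have "inj_on \<tau> (sel \<tau>)" using sel[OF t] A unfolding matchings_def bij_betw_def
        by (auto intro: inj_on_subset)
      then have "card (\<tau> ` sel \<tau>) = rk w p' q' + 1" using sel[OF t] by (simp add: card_image)
      then have "fulton_generator n w (p', q') (sel \<tau>, \<tau> ` sel \<tau>)"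
        using sel[OF t] ess by (simp add: fulton_generator_def minors_def)
      moreover have "card (sel \<tau>) < card A" using sel[OF t] rk cA by simp
      moreover have "sel \<tau> \<subseteq> R" using sel[OF t] A by blast
      ultimately have "tiled (elusive_below n w (R, C)) R (tile \<tau> (sel \<tau>))"
        using less.hyps tM less.prems(4) less_trans by blast
      moreover have "tile \<tau> (sel \<tau>) \<subseteq> tile \<sigma> A" using tile_subset_tile[OF t] sel[OF t] by blast
      ultimately show "tile \<tau> (sel \<tau>) \<subseteq> tile \<sigma> A \<and> tiled (elusive_below n w (R, C)) R (tile \<tau> (sel \<tau>))"
        by blast
    qed (rule stable)
    consider "card (A \<inter> {1..p'}) \<ge> rk w p' q' + 1" "card (\<sigma> ` A \<inter> {1..q'}) = rk w p q + 1"
      | "card (A \<inter> {1..p'}) = rk w p q + 1" "card (\<sigma> ` A \<inter> {1..q'}) \<ge> rk w p' q' + 1"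
      using att by (auto simp: attends_def)
    then show ?thesis
    proof cases
      case 1
      \<comment> \<open>All columns of the minor are columns of the box: Laplace expansion along a fixed set of rows.\<close>
      have "\<sigma> ` A \<inter> {1..q'} = \<sigma> ` A"
        using finA 1(2) cA card_image[OF inj] by (intro card_subset_eq) auto
      then have q': "\<sigma> ` A \<subseteq> {1..q'}" by blast
      obtain A' where A': "A' \<subseteq> A \<inter> {1..p'}" "card A' = rk w p' q' + 1"
        using obtain_subset_with_card_n[OF 1(1)] by blast
      show ?thesis
      proof (rule step[of "\<lambda>_. A'"])
        fix \<tau> assume "\<tau> \<in> tile \<sigma> A"
        then show "A' \<subseteq> A \<inter> {1..p'} \<and> \<tau> ` A' \<subseteq> {1..q'} \<and> card A' = rk w p' q' + 1"
          using A' q' tile_image by blast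
      qed simp
    next
      case 2
      \<comment> \<open>All rows of the minor are rows of the box: Laplace expansion along a fixed set of columns \<open>B'\<close>; the rows then vary with \<open>\<tau>\<close>.\<close>
      have "A \<inter> {1..p'} = A" using finA 2(1) cA by (intro card_subset_eq) auto
      then have p': "A \<subseteq> {1..p'}" by blast
      obtain B' where B': "B' \<subseteq> \<sigma> ` A \<inter> {1..q'}" "card B' = rk w p' q' + 1"
        using obtain_subset_with_card_n[OF 2(2)] by blast
      show ?thesis
      proof (rule step[of "\<lambda>\<tau>. {i \<in> A. \<tau> i \<in> B'}"])
        fix \<tau> assume t: "\<tau> \<in> tile \<sigma> A"
        have "\<tau> \<in> matchings R C" using t tile_subset_matchings[OF \<sigma> A] by blast
        then have "inj_on \<tau> {i \<in> A. \<tau> i \<in> B'}" using A unfolding matchings_def bij_betw_def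
          by (auto intro: inj_on_subset)
        moreover have "B' \<subseteq> \<tau> ` A" using B'(1) unfolding tile_image[OF t] by (rule le_infE)
        then have "\<tau> ` {i \<in> A. \<tau> i \<in> B'} = B'" by fast
        ultimately have "card {i \<in> A. \<tau> i \<in> B'} = card B'" using card_image by metis
        then show "{i \<in> A. \<tau> i \<in> B'} \<subseteq> A \<inter> {1..p'} \<and> \<tau> ` {i \<in> A. \<tau> i \<in> B'} \<subseteq> {1..q'}
            \<and> card {i \<in> A. \<tau> i \<in> B'} = rk w p' q' + 1"
          using B' p' by auto
      next
        fix \<tau> \<upsilon> assume "\<upsilon> \<in> tile \<tau> {i \<in> A. \<tau> i \<in> B'}"
        then obtain \<rho> where r: "\<rho> permutes {i \<in> A. \<tau> i \<in> B'}" "\<upsilon> = \<tau> \<circ> \<rho>" unfolding tile_def by blast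
        have "i \<in> A \<and> \<tau> (\<rho> i) \<in> B' \<longleftrightarrow> i \<in> A \<and> \<tau> i \<in> B'" for i
        proof (cases "i \<in> {i \<in> A. \<tau> i \<in> B'}")
          case True
          then have "\<rho> i \<in> {i \<in> A. \<tau> i \<in> B'}" using permutes_in_image[OF r(1)] by blast
          then show ?thesis using True by blast
        next
          case False
          then show ?thesis using permutes_not_in[OF r(1)] by simp
        qed
        then show "{i \<in> A. \<upsilon> i \<in> B'} = {i \<in> A. \<tau> i \<in> B'}" unfolding r(2) by auto
      qed
    qed
  qed
qed

definition hits :: "nat set \<Rightarrow> (nat \<Rightarrow> nat) \<Rightarrow> nat \<times> nat \<Rightarrow> nat set" where
  "hits R \<sigma> b = {i \<in> R. i \<le> fst b \<and> \<sigma> i \<le> snd b}"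

text \<open>
  The essential boxes that contain enough entries of \<open>\<sigma>\<close> to hold a Fulton generator smaller than the
  whole minor.
\<close>

definition crowded :: "nat \<Rightarrow> (nat \<Rightarrow> nat) \<Rightarrow> nat set \<Rightarrow> (nat \<Rightarrow> nat) \<Rightarrow> (nat \<times> nat) set" where
  "crowded n w R \<sigma> = {b \<in> ess n w. rk w (fst b) (snd b) + 1 < card R \<and>
     rk w (fst b) (snd b) + 1 \<le> card (hits R \<sigma> b)}"

lemma hits_comp_permutes:
  assumes r: "\<rho> permutes A" and A: "A \<subseteq> hits R \<sigma> b"
  shows "hits R (\<sigma> \<circ> \<rho>) b = hits R \<sigma> b"
proof -
  have "i \<in> hits R (\<sigma> \<circ> \<rho>) b \<longleftrightarrow> i \<in> hits R \<sigma> b" for i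
  proof (cases "i \<in> A")
    case True
    then have "\<rho> i \<in> A" using permutes_in_image[OF r] by blast
    then show ?thesis using True A by (auto simp: hits_def)
  next
    case False
    then show ?thesis using permutes_not_in[OF r] by (simp add: hits_def)
  qed
  then show ?thesis by blast
qed

text \<open>
  Permuting the values of \<open>\<sigma>\<close> among some of the first \<open>fst b\<close> rows changes which of these rows have a value of
  at most \<open>snd b\<close>, but not how many: the values occurring in the first \<open>fst b\<close> rows stay the same.
\<close>

lemma card_hits_comp_permutes:
  assumes r: "\<rho> permutes A" and A: "A \<subseteq> R" "\<And>i. i \<in> A \<Longrightarrow> i \<le> fst b"
  shows "card (hits R (\<sigma> \<circ> \<rho>) b) = card (hits R \<sigma> b)"
proof (rule bij_betw_same_card)
  let ?P = "\<lambda>i. i \<in> R \<and> i \<le> fst b"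
  have P: "?P (\<rho> i) \<longleftrightarrow> ?P i" for i
  proof (cases "i \<in> A")
    case True
    then have "\<rho> i \<in> A" using permutes_in_image[OF r] by blast
    then show ?thesis using True A by blast
  next
    case False
    then show ?thesis using permutes_not_in[OF r] by simp
  qed
  have "\<rho> ` hits R (\<sigma> \<circ> \<rho>) b = hits R \<sigma> b"
  proof
    show "\<rho> ` hits R (\<sigma> \<circ> \<rho>) b \<subseteq> hits R \<sigma> b" using P by (auto simp: hits_def)
    show "hits R \<sigma> b \<subseteq> \<rho> ` hits R (\<sigma> \<circ> \<rho>) b"
    proof
      fix j assume j: "j \<in> hits R \<sigma> b"
      have eq: "\<rho> (inv_into UNIV \<rho> j) = j" using permutes_inverses(1)[OF r] .
      have "inv_into UNIV \<rho> j \<in> hits R (\<sigma> \<circ> \<rho>) b" using j P[of "inv_into UNIV \<rho> j"] eq by (simp add: hits_def)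
      then show "j \<in> \<rho> ` hits R (\<sigma> \<circ> \<rho>) b" using eq by force
    qed
  qed
  then show "bij_betw \<rho> (hits R (\<sigma> \<circ> \<rho>) b) (hits R \<sigma> b)"
    using permutes_inj_on[OF r] by (simp add: bij_betw_def)
qed

lemma arg_max_cong_above:
  fixes f :: "'b \<Rightarrow> 'c::linorder"
  assumes "P b" "\<And>x. f b \<le> f x \<Longrightarrow> P x \<longleftrightarrow> Q x"
  shows "arg_max f P = arg_max f Q"
proof -
  have "Q b" using assms by blast
  have "is_arg_max f P x \<longleftrightarrow> is_arg_max f Q x" for x
  proof (cases "f b \<le> f x")
    case True
    then show ?thesis using assms(2) unfolding is_arg_max_def by (meson less_imp_le order_trans)
  next
    case False
    then show ?thesis using assms(1) \<open>Q b\<close> unfolding is_arg_max_def by (meson not_le)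
  qed
  then show ?thesis unfolding arg_max_def by presburger
qed

text \<open>
  The selection rule takes a crowded box that reaches as far down as possible and, among the entries of
  \<open>\<sigma>\<close> in it, as many as the Fulton generators of the box have rows. Permuting within these rows
  may change the number of entries only in boxes that reach less far down. So the box stays
  maximal, its entries keep their rows, and the rule is stable. Preferring boxes
  that end further up would fail: permuting entries of the selected box can make a box above it crowded.
\<close>

lemma crowded_matchings_tiled:
  assumes R: "finite R" "R \<subseteq> {1..}" and C: "finite C" "C \<subseteq> {1..}"
  shows "tiled (elusive_below n w (R, C)) R {\<sigma> \<in> matchings R C. crowded n w R \<sigma> \<noteq> {}}"
    (is "tiled _ _ ?X")
proof -
  define top where "top \<sigma> = arg_max fst (\<lambda>b. b \<in> crowded n w R \<sigma>)" for \<sigma>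
  let ?k = "\<lambda>b. rk w (fst b) (snd b) + 1"
  \<comment> \<open>\<open>SOME\<close> makes a choice that depends only on the box and on the rows that have their entry in it.\<close>
  define sel where "sel \<sigma> = (SOME A. A \<subseteq> hits R \<sigma> (top \<sigma>) \<and> card A = ?k (top \<sigma>))" for \<sigma>
  have top: "top \<sigma> \<in> crowded n w R \<sigma>" if s: "\<sigma> \<in> ?X" for \<sigma>
  proof -
    obtain b where "b \<in> crowded n w R \<sigma>" using s by auto
    moreover have "\<forall>b. b \<in> crowded n w R \<sigma> \<longrightarrow> fst b < Suc n"
      by (auto simp: crowded_def ess_def rothe_diagram_def)
    ultimately show ?thesis unfolding top_def by (rule arg_max_natI)
  qed
  have sel: "sel \<sigma> \<subseteq> hits R \<sigma> (top \<sigma>) \<and> card (sel \<sigma>) = ?k (top \<sigma>)" if "\<sigma> \<in> ?X" for \<sigma>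
  proof -
    have "?k (top \<sigma>) \<le> card (hits R \<sigma> (top \<sigma>))" using top[OF that] by (simp add: crowded_def)
    then have "\<exists>A. A \<subseteq> hits R \<sigma> (top \<sigma>) \<and> card A = ?k (top \<sigma>)"
      using obtain_subset_with_card_n by metis
    then show ?thesis unfolding sel_def by (rule someI_ex)
  qed
  \<comment> \<open>Rearranging \<open>\<sigma>\<close> within the selected rows, all of which are at most \<open>fst (top \<sigma>)\<close>, keeps the number of
    entries in every box that reaches at least as far down.\<close>
  have above: "b \<in> crowded n w R \<tau> \<longleftrightarrow> b \<in> crowded n w R \<sigma>"
    if s: "\<sigma> \<in> ?X" and t: "\<tau> \<in> tile \<sigma> (sel \<sigma>)" and b: "fst (top \<sigma>) \<le> fst b" for \<sigma> \<tau> b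
  proof -
    obtain \<rho> where r: "\<rho> permutes sel \<sigma>" "\<tau> = \<sigma> \<circ> \<rho>" using t unfolding tile_def by blast
    have "card (hits R \<tau> b) = card (hits R \<sigma> b)"
      unfolding r(2) using sel[OF s] b
      by (intro card_hits_comp_permutes[OF r(1)]) (auto simp: hits_def)
    then show ?thesis by (simp add: crowded_def)
  qed
  have selR: "sel \<sigma> \<subseteq> R" if "\<sigma> \<in> ?X" for \<sigma>
    using sel[OF that] unfolding hits_def by blast
  show ?thesis
  proof (rule tiled_by_stable_choice[where sel = sel])
    show "finite ?X" using finite_matchings[OF R(1) C(1)] by simp
  next
    fix \<sigma> assume s: "\<sigma> \<in> ?X"
    then have sM: "\<sigma> \<in> matchings R C" by simp
    have "tile \<sigma> (sel \<sigma>) \<subseteq> ?X"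
    proof
      fix \<tau> assume t: "\<tau> \<in> tile \<sigma> (sel \<sigma>)"
      have "top \<sigma> \<in> crowded n w R \<tau>" using above[OF s t] top[OF s] by blast
      then show "\<tau> \<in> ?X" using t tile_subset_matchings[OF sM selR[OF s]] by auto
    qed
    moreover have "tiled (elusive_below n w (R, C)) R (tile \<sigma> (sel \<sigma>))"
    proof (rule fulton_generator_tile_tiled[OF R(1) C(1) sM selR[OF s]])
      have "inj_on \<sigma> (sel \<sigma>)" using sM selR[OF s] unfolding matchings_def bij_betw_def
        by (auto intro: inj_on_subset)
      then have "card (\<sigma> ` sel \<sigma>) = ?k (top \<sigma>)" using sel[OF s] by (simp add: card_image)
      moreover have "sel \<sigma> \<subseteq> {1..fst (top \<sigma>)}" using sel[OF s] R(2) unfolding hits_def by fastforce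
      moreover have "\<sigma> ` sel \<sigma> \<subseteq> {1..snd (top \<sigma>)}"
      proof -
        have "\<sigma> ` R \<subseteq> {1..}" using sM C(2) by (auto simp: matchings_def bij_betw_def)
        then show ?thesis using sel[OF s] by (fastforce simp: hits_def)
      qed
      moreover have "top \<sigma> \<in> ess n w" using top[OF s] by (simp add: crowded_def)
      ultimately show "fulton_generator n w (top \<sigma>) (sel \<sigma>, \<sigma> ` sel \<sigma>)"
        using sel[OF s] by (simp add: fulton_generator_def minors_def case_prod_beta)
      show "card (sel \<sigma>) < card R" using sel[OF s] top[OF s] by (simp add: crowded_def)
    qed
    ultimately show "tile \<sigma> (sel \<sigma>) \<subseteq> ?X \<and> tiled (elusive_below n w (R, C)) R (tile \<sigma> (sel \<sigma>))"
      by (rule conjI)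
  next
    fix \<sigma> \<tau> assume s: "\<sigma> \<in> ?X" and t: "\<tau> \<in> tile \<sigma> (sel \<sigma>)"
    have "top \<tau> = top \<sigma>"
      unfolding top_def
      by (rule arg_max_cong_above[symmetric, where b = "top \<sigma>"])
        (use top[OF s] above[OF s t] in blast)+
    moreover have "hits R \<tau> (top \<sigma>) = hits R \<sigma> (top \<sigma>)"
      using t hits_comp_permutes sel[OF s] unfolding tile_def by blast
    ultimately show "sel \<tau> = sel \<sigma>" by (simp add: sel_def)
  qed
qed

text \<open>
  Membership in a tile of an elusive minor gives one direction; for the other, the entries of the matching in
  the rows of an elusive minor all lie in the box of that minor.
\<close>

lemma crowded_iff_contains_elusive:
  assumes R: "finite R" "R \<subseteq> {1..}" and C: "finite C" "C \<subseteq> {1..}" and s: "\<sigma> \<in> matchings R C"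
  shows "crowded n w R \<sigma> \<noteq> {} \<longleftrightarrow> (\<exists>f\<in>elusive_below n w (R, C). \<sigma> ` fst f = snd f)"
proof
  assume "crowded n w R \<sigma> \<noteq> {}"
  then show "\<exists>f\<in>elusive_below n w (R, C). \<sigma> ` fst f = snd f"
    using tiled_contains_minor[OF crowded_matchings_tiled[OF R C]] s by blast
next
  assume "\<exists>f\<in>elusive_below n w (R, C). \<sigma> ` fst f = snd f"
  then obtain A B where f: "(A, B) \<in> elusive_below n w (R, C)" and AB: "\<sigma> ` A = B" by auto
  then obtain p q where fulton: "fulton_generator n w (p, q) (A, B)"
    unfolding elusive_below_def elusive_def by blast
  have sub: "A \<subseteq> R" "(A, B) \<noteq> (R, C)"
    using f by (auto simp: elusive_below_def strictly_contained_def contained_def)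
  have "A \<noteq> R" using sub(2) AB s by (auto simp: matchings_def bij_betw_def)
  then have "card A < card R" using sub(1) R(1) by (simp add: psubset_card_mono psubsetI)
  moreover have cA: "card A = rk w p q + 1" using fulton by (simp add: fulton_generator_def minors_def)
  moreover have "A \<subseteq> hits R \<sigma> (p, q)"
    using fulton AB sub(1) by (fastforce simp: hits_def fulton_generator_def minors_def)
  then have "card A \<le> card (hits R \<sigma> (p, q))" using R(1) by (intro card_mono) (simp_all add: hits_def)
  ultimately have "(p, q) \<in> crowded n w R \<sigma>" using fulton by (simp add: crowded_def fulton_generator_def)
  then show "crowded n w R \<sigma> \<noteq> {}" by blast
qed

section \<open>Reduction\<close>

lemma lead_term_in_keys:
  fixes P :: "'a::field polynomial"
  assumes ord: "term_order n tord" and sub: "Poly_Mapping.keys P \<subseteq> terms_upto n" and "P \<noteq> 0"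
  shows "lead_term tord P \<in> Poly_Mapping.keys P"
proof -
  let ?K = "Poly_Mapping.keys P"
  have lin: "linear_order_on (terms_upto n) tord" using ord by (simp add: term_order_def)
  then have refl: "\<And>x. x \<in> terms_upto n \<Longrightarrow> (x, x) \<in> tord" and tr: "trans tord" and anti: "antisym tord"
    and tot: "total_on (terms_upto n) tord"
    unfolding linear_order_on_def partial_order_on_def preorder_on_def by (blast dest: refl_onD)+
  have ex: "F \<subseteq> terms_upto n \<Longrightarrow> \<exists>t\<in>F. \<forall>s\<in>F. (s, t) \<in> tord" if "finite F" "F \<noteq> {}" for F
    using that
  proof (induction F rule: finite_ne_induct)
    case (singleton x)
    then show ?case using refl by auto
  next
    case (insert x F)
    then obtain t where t: "t \<in> F" "\<forall>s\<in>F. (s, t) \<in> tord" by auto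
    have "(x, t) \<in> tord \<or> (t, x) \<in> tord"
      using tot insert.prems t(1) refl unfolding total_on_def by (metis insert_subset subsetD)
    then show ?case
    proof
      assume "(t, x) \<in> tord"
      then have "\<forall>s\<in>insert x F. (s, x) \<in> tord"
        using t(2) refl[of x] insert.prems transD[OF tr, of _ t x] by blast
      then show ?thesis by blast
    qed (use t in blast)
  qed
  have "?K \<noteq> {}" using \<open>P \<noteq> 0\<close> by simp
  then obtain t where t: "t \<in> ?K" "\<forall>s\<in>?K. (s, t) \<in> tord" using ex[OF finite_keys] sub by blast
  then have "lead_term tord P = t"
    unfolding lead_term_def by (intro the_equality) (use t anti in \<open>blast dest: antisymD\<close>)+
  then show ?thesis using t by simp
qed

text \<open>
  The terms of a minor involve only variables of the \<open>n \<times> n\<close> matrix. On such monomials the order is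
  total, so one of the terms is the leading one, and it is the monomial of a matching.
\<close>

lemma lead_term_minor_poly:
  assumes ord: "term_order n tord" and "A \<subseteq> {1..n}" "B \<subseteq> {1..n}" "card A = card B"
  shows "minor_poly (A, B) \<noteq> (0 :: 'a::field polynomial)"
    and "lead_term tord (minor_poly (A, B) :: 'a polynomial) \<in> graph_term A ` matchings A B"
proof -
  have fin: "finite A" "finite B" using assms finite_subset by blast+
  note k = keys_minor_poly[OF fin assms(4), where ?'a = 'a]
  obtain \<sigma> where "bij_betw \<sigma> A B" using fin assms(4) finite_same_card_bij by blast
  then have ne: "matchings A B \<noteq> {}" using restrict_in_matchings(1) by blast
  show nz: "minor_poly (A, B) \<noteq> (0 :: 'a polynomial)" using k ne by auto
  have "graph_term A \<tau> \<in> terms_upto n" if t: "\<tau> \<in> matchings A B" for \<tau>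
  proof -
    have "\<tau> ` A = B" using t by (simp add: matchings_def bij_betw_def)
    have "Poly_Mapping.keys (graph_term A \<tau>) \<subseteq> (\<Union>i\<in>A. {(i, \<tau> i)})"
      unfolding graph_term_def using keys_sum[of "\<lambda>i. Poly_Mapping.single (i, \<tau> i) (1::nat)" A] by simp
    also have "\<dots> \<subseteq> {1..n} \<times> {1..n}" using \<open>\<tau> ` A = B\<close> assms(2,3) by blast
    finally show ?thesis by (simp add: terms_upto_def)
  qed
  then have "Poly_Mapping.keys (minor_poly (A, B) :: 'a polynomial) \<subseteq> terms_upto n" unfolding k by blast
  then show "lead_term tord (minor_poly (A, B) :: 'a polynomial) \<in> graph_term A ` matchings A B"
    using lead_term_in_keys[OF ord _ nz] k by blast
qed

text \<open>
  One reduction step by the minor \<open>(A, \<sigma> ` A)\<close> cancels a tile. The step is made at the term of the tile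
  which is divisible by the leading term; since the signs in the tile and in the minor differ
  by a constant factor, the multiple of the minor that cancels this term cancels the other terms of the tile as well.
\<close>

lemma red_step_removes_tile:
  fixes R C :: "nat set"
  defines "M \<equiv> minor_poly (R, C) :: 'a::field polynomial"
  assumes ord: "term_order n tord" and R: "R \<subseteq> {1..n}" and C: "C \<subseteq> {1..n}"
    and \<sigma>: "\<sigma> \<in> matchings R C" and A: "A \<subseteq> R" and F: "(A, \<sigma> ` A) \<in> F"
    and X: "X \<subseteq> matchings R C" "tile \<sigma> A \<subseteq> X"
  shows "red_step tord (minor_poly ` F) (part_poly (R, C) X :: 'a polynomial) (part_poly (R, C) (X - tile \<sigma> A))"
proof -
  have finR: "finite R" by (rule finite_subset[OF R]) simp
  have finC: "finite C" by (rule finite_subset[OF C]) simp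
  have finA: "finite A" by (rule finite_subset[OF A finR])
  have finX: "finite X" by (rule finite_subset[OF X(1) finite_matchings[OF finR finC]])
  have bij: "bij_betw \<sigma> R C" using \<sigma> by (simp add: matchings_def)
  define B where "B = \<sigma> ` A"
  have bijA: "bij_betw \<sigma> A B" unfolding B_def by (rule bij_betw_submatching(1)[OF \<sigma> A refl])
  define Q where "Q = (minor_poly (A, B) :: 'a polynomial)"
  have BC: "B \<subseteq> C" using A bij by (auto simp: B_def bij_betw_def)
  have An: "A \<subseteq> {1..n}" and Bn: "B \<subseteq> {1..n}" using A R BC C by blast+
  note cAB = bij_betw_same_card[OF bijA]
  have Q0: "Q \<noteq> 0" and lead: "lead_term tord Q \<in> graph_term A ` matchings A B"
    unfolding Q_def by (rule lead_term_minor_poly[OF ord An Bn cAB])+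
  define \<epsilon> where "\<epsilon> = Poly_Mapping.lookup Q (graph_term A \<sigma>)"
  have e: "\<epsilon> \<in> {1, -1}" unfolding \<epsilon>_def Q_def by (rule coeff_minor_poly[OF finA bijA])
  have Q: "Q = (\<Sum>\<rho> | \<rho> permutes A. Poly_Mapping.single (graph_term A (\<sigma> \<circ> \<rho>)) (of_int (sign \<rho>) * \<epsilon>))"
    unfolding \<epsilon>_def Q_def by (rule minor_poly_eq_sum[OF finA bijA])
  have "lead_term tord Q \<in> Poly_Mapping.keys Q"
    using lead unfolding Q_def keys_minor_poly[OF finA finite_subset[OF BC finC] cAB] .
  also have "Poly_Mapping.keys Q \<subseteq> (\<Union>\<rho>\<in>{\<rho>. \<rho> permutes A}.
      Poly_Mapping.keys (Poly_Mapping.single (graph_term A (\<sigma> \<circ> \<rho>)) (of_int (sign \<rho>) * \<epsilon>)))"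
    unfolding Q by (rule keys_sum)
  finally obtain \<rho>\<^sub>0 where r0: "\<rho>\<^sub>0 permutes A"
    and "lead_term tord Q \<in> Poly_Mapping.keys
      (Poly_Mapping.single (graph_term A (\<sigma> \<circ> \<rho>\<^sub>0)) (of_int (sign \<rho>\<^sub>0) * \<epsilon>))" by auto
  then have lead0: "lead_term tord Q = graph_term A (\<sigma> \<circ> \<rho>\<^sub>0)" by (simp split: if_splits)
  \<comment> \<open>Multiplication by \<open>u\<close> turns the terms of \<open>Q\<close> into the terms of the tile.\<close>
  define u where "u = graph_term (R - A) \<sigma>"
  have split: "graph_term R (\<sigma> \<circ> \<rho>) = u + graph_term A (\<sigma> \<circ> \<rho>)" if "\<rho> permutes A" for \<rho>
  proof -
    have "graph_term (R - A) (\<sigma> \<circ> \<rho>) = u"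
      unfolding u_def using permutes_not_in[OF that] by (intro graph_term_cong) simp
    then show ?thesis using graph_term_split[OF finR A] by (simp add: add.commute)
  qed
  define c where "c = Poly_Mapping.lookup M (graph_term R \<sigma>)"
  have coeff: "Poly_Mapping.lookup M (graph_term R (\<sigma> \<circ> \<rho>)) = of_int (sign \<rho>) * c" if "\<rho> permutes A" for \<rho>
    unfolding M_def c_def by (rule coeff_minor_poly_comp[OF finR bij permutes_subset[OF that A]])
  have leadQ: "lead_coef tord Q = of_int (sign \<rho>\<^sub>0) * \<epsilon>"
    unfolding lead_coef_def lead0 unfolding \<epsilon>_def Q_def by (rule coeff_minor_poly_comp[OF finA bijA r0])
  define t where "t = graph_term R (\<sigma> \<circ> \<rho>\<^sub>0)"
  have tX: "\<sigma> \<circ> \<rho>\<^sub>0 \<in> X" using X(2) r0 unfolding tile_def by blast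
  have lt: "Poly_Mapping.lookup (part_poly (R, C) X :: 'a polynomial) t = of_int (sign \<rho>\<^sub>0) * c"
    unfolding t_def lookup_part_poly[OF finR finC X(1) tX] using coeff[OF r0] by (simp add: M_def)
  have c0: "c \<in> {1, -1}" unfolding c_def M_def by (rule coeff_minor_poly[OF finR bij])
  then have tkeys: "t \<in> Poly_Mapping.keys (part_poly (R, C) X :: 'a polynomial)"
    unfolding in_keys_iff lt by (cases \<rho>\<^sub>0 rule: sign_cases) auto
  have ut: "t = lead_term tord Q + u" unfolding t_def lead0 split[OF r0] by (rule add.commute)
  \<comment> \<open>The signs of \<open>\<rho>\<^sub>0\<close> cancel, so the multiple of \<open>Q\<close> does not depend on which term of \<open>Q\<close> leads;
    and \<open>1 / \<epsilon> = \<epsilon>\<close>.\<close>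
  have quot: "Poly_Mapping.lookup (part_poly (R, C) X :: 'a polynomial) t / lead_coef tord Q = \<epsilon> * c"
    unfolding lt leadQ using e by (cases \<rho>\<^sub>0 rule: sign_cases) auto
  have "Poly_Mapping.single u (\<epsilon> * c) * Q = (\<Sum>\<rho> | \<rho> permutes A.
      Poly_Mapping.single (graph_term R (\<sigma> \<circ> \<rho>)) (Poly_Mapping.lookup M (graph_term R (\<sigma> \<circ> \<rho>))))"
    unfolding Q sum_distrib_left
  proof (intro sum.cong refl)
    fix \<rho> assume "\<rho> \<in> {\<rho>. \<rho> permutes A}"
    then have r: "\<rho> permutes A" by simp
    have cancel: "\<epsilon> * c * (of_int (sign \<rho>) * \<epsilon>) = of_int (sign \<rho>) * c" using e by auto
    show "Poly_Mapping.single u (\<epsilon> * c) * Poly_Mapping.single (graph_term A (\<sigma> \<circ> \<rho>)) (of_int (sign \<rho>) * \<epsilon>)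
      = Poly_Mapping.single (graph_term R (\<sigma> \<circ> \<rho>)) (Poly_Mapping.lookup M (graph_term R (\<sigma> \<circ> \<rho>)))"
      by (simp only: coeff[OF r] split[OF r, symmetric] mult_single cancel)
  qed
  also have "\<dots> = part_poly (R, C) (tile \<sigma> A)"
  proof -
    have "inj_on (\<lambda>\<rho>. \<sigma> \<circ> \<rho>) {\<rho>. \<rho> permutes A}"
    proof (rule inj_onI)
      fix \<rho> \<rho>' assume p: "\<rho> \<in> {\<rho>. \<rho> permutes A}" "\<rho>' \<in> {\<rho>. \<rho> permutes A}" and eq: "\<sigma> \<circ> \<rho> = \<sigma> \<circ> \<rho>'"
      show "\<rho> = \<rho>'"
      proof
        fix i
        show "\<rho> i = \<rho>' i"
        proof (cases "i \<in> A")
          case True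
          then have "\<rho> i \<in> A" "\<rho>' i \<in> A" using p permutes_in_image by fastforce+
          then show ?thesis using fun_cong[OF eq, of i] bijA by (auto simp: bij_betw_def inj_on_def)
        qed (use p in \<open>simp add: permutes_not_in\<close>)
      qed
    qed
    note inj = this
    have img: "tile \<sigma> A = (\<lambda>\<rho>. \<sigma> \<circ> \<rho>) ` {\<rho>. \<rho> permutes A}" unfolding tile_def by (rule setcompr_eq_image)
    show ?thesis unfolding part_poly_def img sum.reindex[OF inj] by (simp add: M_def)
  qed
  finally have tile: "Poly_Mapping.single u (\<epsilon> * c) * Q = part_poly (R, C) (tile \<sigma> A)" .
  have "t - lead_term tord Q = u" unfolding ut by simp
  then have "part_poly (R, C) (X - tile \<sigma> A) = part_poly (R, C) X
      - Poly_Mapping.single (t - lead_term tord Q)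
          (Poly_Mapping.lookup (part_poly (R, C) X) t / lead_coef tord Q) * Q"
    unfolding quot using tile part_poly_Diff[OF finX X(2), of "(R, C)", where ?'a = 'a] by simp
  moreover have "term_dvd (lead_term tord Q) t" unfolding term_dvd_def using ut by blast
  moreover have "Q \<in> minor_poly ` F" using F unfolding Q_def B_def by (rule imageI)
  ultimately show ?thesis unfolding red_step_def using Q0 tkeys
    by (intro bexI[of _ Q] bexI[of _ t] conjI)
qed

lemma red_steps_remove_tiled:
  assumes ord: "term_order n tord" and R: "R \<subseteq> {1..n}" and C: "C \<subseteq> {1..n}"
  shows "tiled F R Y \<Longrightarrow> Y \<subseteq> X \<Longrightarrow> X \<subseteq> matchings R C \<Longrightarrow>
    (red_step tord (minor_poly ` F))\<^sup>*\<^sup>* (part_poly (R, C) X :: 'a::field polynomial) (part_poly (R, C) (X - Y))"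
proof (induction arbitrary: X rule: tiled.induct)
  case empty
  then show ?case by simp
next
  case (insert Y A \<sigma>)
  have sub: "tile \<sigma> A \<subseteq> X" "\<sigma> \<in> matchings R C" using insert.prems self_in_tile by blast+
  have "red_step tord (minor_poly ` F) (part_poly (R, C) X :: 'a polynomial) (part_poly (R, C) (X - tile \<sigma> A))"
    by (rule red_step_removes_tile[OF ord R C sub(2) insert.hyps(2,3) insert.prems(2) sub(1)])
  moreover have "(red_step tord (minor_poly ` F))\<^sup>*\<^sup>* (part_poly (R, C) (X - tile \<sigma> A) :: 'a polynomial)
      (part_poly (R, C) (X - tile \<sigma> A - Y))"
    using insert.prems insert.hyps(4) by (intro insert.IH) blast+
  ultimately show ?case by (simp add: Diff_eq Int_assoc)
qed

theorem theorem5p4: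
  fixes n :: nat and w :: "nat \<Rightarrow> nat" and tord :: "monomial rel" and m :: minor
  assumes "w permutes {1..n}"
    and "\<not> vexillary n w"
    and "antidiagonal_order TYPE('a::field) n tord"
    and "elusive n w m"
  shows "(\<forall>t \<in> Poly_Mapping.keys (minor_poly m :: 'a polynomial).
            Poly_Mapping.lookup (minor_poly m :: 'a polynomial) t = 1 \<or>
            Poly_Mapping.lookup (minor_poly m :: 'a polynomial) t = -1) \<and>
         reduces_to tord (minor_poly ` elusive_below n w m) (minor_poly m :: 'a polynomial)
           (\<Sum>t \<in> Poly_Mapping.keys (minor_poly m :: 'a polynomial)
                  - removed_terms_set TYPE('a) m (elusive_below n w m).
              Poly_Mapping.single t (Poly_Mapping.lookup (minor_poly m) t))"
proof -
  obtain R C where m: "m = (R, C)" by fastforce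
  obtain p q where "(p, q) \<in> ess n w" "(R, C) \<in> minors p q (rk w p q + 1)"
    using assms(4) unfolding elusive_def m fulton_generator_def by blast
  then have R: "R \<subseteq> {1..n}" and C: "C \<subseteq> {1..n}" and card: "card R = card C"
    by (auto simp: ess_def rothe_diagram_def minors_def)
  have fin: "finite R" "finite C" using R C finite_subset by blast+
  have ord: "term_order n tord" using assms(3) by (simp add: antidiagonal_order_def)
  let ?M = "minor_poly (R, C) :: 'a polynomial" and ?F = "elusive_below n w (R, C)"
  let ?S = "matchings R C"
  let ?Y = "{\<sigma> \<in> ?S. crowded n w R \<sigma> \<noteq> {}}"
  note keys = keys_minor_poly[OF fin card, where ?'a = 'a]
  have R1: "R \<subseteq> {1..}" and C1: "C \<subseteq> {1..}" using R C by auto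
  have F: "A \<subseteq> R \<and> B \<subseteq> C \<and> card A = card B" if "(A, B) \<in> ?F" for A B
    using that unfolding elusive_below_def elusive_def
    by (auto simp: strictly_contained_def contained_def fulton_generator_def minors_def)
  have Y: "\<sigma> \<in> ?Y \<longleftrightarrow> (\<exists>f\<in>?F. \<sigma> ` fst f = snd f)" if "\<sigma> \<in> ?S" for \<sigma>
    using crowded_iff_contains_elusive[OF fin(1) R1 fin(2) C1 that, of n w] that by simp
  have removed: "graph_term R \<sigma> \<in> removed_terms_set TYPE('a) (R, C) ?F \<longleftrightarrow> \<sigma> \<in> ?Y" if "\<sigma> \<in> ?S" for \<sigma>
  proof -
    have "graph_term R \<sigma> \<in> removed_terms TYPE('a) (R, C) f \<longleftrightarrow> \<sigma> ` fst f = snd f" if "f \<in> ?F" for f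
    proof -
      obtain A B where f: "f = (A, B)" by fastforce
      then show ?thesis
        using F that graph_term_removed_iff[OF fin \<open>\<sigma> \<in> ?S\<close>, where ?'a = 'a] by (metis fst_conv snd_conv)
    qed
    then have "graph_term R \<sigma> \<in> removed_terms_set TYPE('a) (R, C) ?F \<longleftrightarrow> (\<exists>f\<in>?F. \<sigma> ` fst f = snd f)"
      unfolding removed_terms_set_def by simp
    then show ?thesis using Y[OF that] by simp
  qed
  have "Poly_Mapping.keys ?M - removed_terms_set TYPE('a) (R, C) ?F = graph_term R ` (?S - ?Y)"
    unfolding keys using removed by blast
  then have final: "(\<Sum>t \<in> Poly_Mapping.keys ?M - removed_terms_set TYPE('a) (R, C) ?F.
      Poly_Mapping.single t (Poly_Mapping.lookup ?M t)) = part_poly (R, C) (?S - ?Y)"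
    unfolding part_poly_def
    by (simp add: sum.reindex[OF inj_on_subset[OF inj_on_graph_term[OF fin(1)] Diff_subset]])
  have "(red_step tord (minor_poly ` ?F))\<^sup>*\<^sup>* ?M (part_poly (R, C) (?S - ?Y))"
    using red_steps_remove_tiled[OF ord R C crowded_matchings_tiled[OF fin(1) R1 fin(2) C1, of n w], of ?S, where ?'a = 'a]
    unfolding part_poly_matchings[OF fin card] by blast
  moreover have "\<not> reducible tord (minor_poly ` ?F) (part_poly (R, C) (?S - ?Y) :: 'a polynomial)"
  proof
    assume "reducible tord (minor_poly ` ?F) (part_poly (R, C) (?S - ?Y) :: 'a polynomial)"
    then obtain t A B where t: "t \<in> Poly_Mapping.keys (part_poly (R, C) (?S - ?Y) :: 'a polynomial)"
      and AB: "(A, B) \<in> ?F" and dvd: "term_dvd (lead_term tord (minor_poly (A, B) :: 'a polynomial)) t"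
      unfolding reducible_def by auto
    obtain \<sigma> where s: "\<sigma> \<in> ?S - ?Y" and ts: "t = graph_term R \<sigma>"
      using t keys_part_poly by (metis (no_types, lifting) fst_conv imageE subsetD)
    have "A \<subseteq> {1..n}" "B \<subseteq> {1..n}" "card A = card B" using F[OF AB] R C by auto
    from lead_term_minor_poly(2)[OF ord this, where ?'a = 'a] obtain \<tau> where
      tau: "\<tau> \<in> matchings A B" and "lead_term tord (minor_poly (A, B) :: 'a polynomial) = graph_term A \<tau>"
      by blast
    then obtain u where "graph_term R \<sigma> = graph_term A \<tau> + u" using dvd ts unfolding term_dvd_def by auto
    then have "\<And>i. i \<in> A \<Longrightarrow> \<sigma> i = \<tau> i"
      using graph_term_agree fin(1) finite_subset[of A R] F[OF AB] by blast
    then have "\<sigma> ` A = \<tau> ` A" by (intro image_cong) auto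
    then have "\<sigma> ` A = B" using tau by (simp add: matchings_def bij_betw_def)
    then have "\<exists>f\<in>?F. \<sigma> ` fst f = snd f" using AB by (intro bexI[of _ "(A, B)"]) simp_all
    then have "\<sigma> \<in> ?Y" using Y[of \<sigma>] s by simp
    then show False using s by blast
  qed
  moreover have "Poly_Mapping.lookup ?M t = 1 \<or> Poly_Mapping.lookup ?M t = -1"
    if "t \<in> Poly_Mapping.keys ?M" for t
    using that coeff_minor_poly[OF fin(1), where ?'a = 'a] unfolding keys matchings_def by fastforce
  ultimately show ?thesis unfolding m final reduces_to_def by blast
qed

end
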